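(* Let $\rho$ be a qubit state (a density operator on $\mathbb{C}^2$), and let $\mathbb{X}=\{|x\rangle\}$ and $\mathbb{Z}=\{|z\rangle\}$ be two measurement bases (orthonormal bases) of $\mathbb{C}^2$. Let $c=\max_{|x\rangle\in\mathbb{X},\,|z\rangle\in\mathbb{Z}}|\langle x|z\rangle|^2$ and let $P=\mathrm{Tr}[\rho^2]$. Then $$C^{\mathbb{X}}_{\mathrm{CF}}(\rho)+C^{\mathbb{Z}}_{\mathrm{CF}}(\rho)\ \ge\ H\left(\frac{1+\sqrt{1-4(2P-1)\sqrt{c}\,(1-\sqrt{c})}}{2}\right).$$
   Context: For a density operator $\rho$, $H(\rho)=-\mathrm{Tr}[\rho\log_2\rho]$ is the von Neumann entropy. For a real number $q\in[0,1]$, $H(q)=-q\log_2 q-(1-q)\log_2(1-q)$ is the binary Shannon entropy (with $0\log_2 0=0$). For an orthonormal basis $\mathbb{J}=\{|i\rangle\}$, the relative entropy of coherence is $C^{\mathbb{J}}_{\mathrm{RE}}(\rho)=H(\rho^{\mathrm{diag}})-H(\rho)$, where $\rho^{\mathrm{diag}}=\sum_i\langle i|\rho|i\rangle\,|i\rangle\langle i|$. The coherence of formation is $C^{\mathbb{J}}_{\mathrm{CF}}(\rho)=\min_{\{p_e,|\psi_e\rangle\}}\sum_e p_e\,C^{\mathbb{J}}_{\mathrm{RE}}(|\psi_e\rangle\langle\psi_e|)$, where the minimization is over all decompositions $\rho=\sum_e p_e|\psi_e\rangle\langle\psi_e|$ of $\rho$ into pure states (unit vectors $|\psi_e\rangle$)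 with $(p_e)$ a probability distribution. *)

theory Defs
  imports "HOL-Analysis.Analysis"
begin

definition cinner :: "complex ^ 'n \<Rightarrow> complex ^ 'n \<Rightarrow> complex" where
  "cinner u v = (\<Sum>i\<in>UNIV. cnj (u $ i) * v $ i)"

definition ketbra :: "complex ^ 'n \<Rightarrow> complex ^ 'n \<Rightarrow> complex ^ 'n ^ 'n" where
  "ketbra u v = (\<chi> i j. u $ i * cnj (v $ j))"

definition dagger :: "complex ^ 'n ^ 'n \<Rightarrow> complex ^ 'n ^ 'n" where
  "dagger A = (\<chi> i j. cnj (A $ j $ i))"

definition unitary :: "complex ^ 'n ^ 'n \<Rightarrow> bool" where
  "unitary U \<longleftrightarrow> dagger U ** U = mat 1 \<and> U ** dagger U = mat 1"

definition real_diag :: "('n \<Rightarrow> real) \<Rightarrow> complex ^ 'n ^ 'n" where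
  "real_diag d = (\<chi> i j. if i = j then complex_of_real (d i) else 0)"

definition density_operator :: "complex ^ 'n ^ 'n \<Rightarrow> bool" where
  "density_operator \<rho> \<longleftrightarrow>
     dagger \<rho> = \<rho> \<and> (\<forall>v. 0 \<le> Re (cinner v (\<rho> *v v))) \<and> trace \<rho> = 1"

definition orthonormal_basis :: "(complex ^ 'n) set \<Rightarrow> bool" where
  "orthonormal_basis B \<longleftrightarrow>
     (\<forall>u\<in>B. \<forall>v\<in>B. cinner u v = (if u = v then 1 else 0)) \<and> vec.span B = UNIV"

definition spectral_fun_rel ::
  "(real \<Rightarrow> real) \<Rightarrow> complex ^ 'n ^ 'n \<Rightarrow> complex ^ 'n ^ 'n \<Rightarrow> bool" where
  "spectral_fun_rel f A B \<longleftrightarrow>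
     (\<exists>U d. unitary U \<and> A = U ** real_diag d ** dagger U \<and>
            B = U ** real_diag (\<lambda>i. f (d i)) ** dagger U)"

(* The result does not depend on the chosen diagonalization; a diagonalization exists
   exactly when the matrix is Hermitian. *)
lemma spectral_fun_rel_unique:
  assumes "spectral_fun_rel f A B" and "spectral_fun_rel f A C"
  shows "B = C"
proof -
  obtain U d where U: "unitary U" "A = U ** real_diag d ** dagger U"
      "B = U ** real_diag (\<lambda>i. f (d i)) ** dagger U"
    using assms(1) unfolding spectral_fun_rel_def by blast
  obtain V e where V: "unitary V" "A = V ** real_diag e ** dagger V"
      "C = V ** real_diag (\<lambda>i. f (e i)) ** dagger V"
    using assms(2) unfolding spectral_fun_rel_def by blast
  have cU: "U ** dagger U = mat 1" "dagger U ** U = mat 1" "V ** dagger V = mat 1" "dagger V ** V = mat 1"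
    using U(1) V(1) by (auto simp: unitary_def)
  define W where "W = dagger V ** U"
  have L: "(W ** real_diag g) $ i $ j = W $ i $ j * complex_of_real (g j)" for g i j
    by (simp add: matrix_matrix_mult_def real_diag_def if_distrib[of "\<lambda>x. _ * x"] cong: if_cong)
  have R: "(real_diag g ** W) $ i $ j = complex_of_real (g i) * W $ i $ j" for g i j
    by (simp add: matrix_matrix_mult_def real_diag_def if_distrib[of "\<lambda>x. x * _"] cong: if_cong)
  have "W ** real_diag d = dagger V ** A ** U"
    unfolding U(2) W_def by (metis cU(2) matrix_mul_assoc matrix_mul_rid)
  also have "\<dots> = real_diag e ** W"
    unfolding V(2) W_def by (metis cU(4) matrix_mul_assoc matrix_mul_lid)
  finally have eq: "W ** real_diag d = real_diag e ** W" .
  have "W $ i $ j * complex_of_real (f (d j)) = complex_of_real (f (e i)) * W $ i $ j" for i j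
  proof (cases "W $ i $ j = 0")
    case False
    have "W $ i $ j * complex_of_real (d j) = complex_of_real (e i) * W $ i $ j"
      by (metis L R eq)
    with False have "d j = e i" by simp
    then show ?thesis by simp
  qed simp
  then have fW: "W ** real_diag (\<lambda>i. f (d i)) = real_diag (\<lambda>i. f (e i)) ** W"
    by (simp add: vec_eq_iff L R)
  have "B = V ** (W ** real_diag (\<lambda>i. f (d i))) ** dagger U"
    unfolding U(3) W_def by (metis cU(3) matrix_mul_assoc matrix_mul_lid)
  also have "\<dots> = C"
    unfolding fW V(3) unfolding W_def by (metis cU(1) matrix_mul_assoc matrix_mul_rid)
  finally show ?thesis .
qed

definition spectral_fun :: "(real \<Rightarrow> real) \<Rightarrow> complex ^ 'n ^ 'n \<Rightarrow> complex ^ 'n ^ 'n" where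
  "spectral_fun f A = (THE B. spectral_fun_rel f A B)"

(* The value that log 2 takes at 0 is irrelevant below: it is multiplied by the eigenvalue 0. *)
definition vn_entropy :: "complex ^ 'n ^ 'n \<Rightarrow> real" where
  "vn_entropy \<rho> = - Re (trace (\<rho> ** spectral_fun (log 2) \<rho>))"

definition binary_entropy :: "real \<Rightarrow> real" where
  "binary_entropy q = - q * log 2 q - (1 - q) * log 2 (1 - q)"

definition diag_part :: "(complex ^ 'n) set \<Rightarrow> complex ^ 'n ^ 'n \<Rightarrow> complex ^ 'n ^ 'n" where
  "diag_part B \<rho> = (\<Sum>b\<in>B. \<chi> i j. cinner b (\<rho> *v b) * ketbra b b $ i $ j)"

definition coherence_RE :: "(complex ^ 'n) set \<Rightarrow> complex ^ 'n ^ 'n \<Rightarrow> real" where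
  "coherence_RE B \<rho> = vn_entropy (diag_part B \<rho>) - vn_entropy \<rho>"

definition pure_decomposition ::
  "complex ^ 'n ^ 'n \<Rightarrow> nat \<Rightarrow> (nat \<Rightarrow> real) \<Rightarrow> (nat \<Rightarrow> complex ^ 'n) \<Rightarrow> bool" where
  "pure_decomposition \<rho> k p \<psi> \<longleftrightarrow>
     (\<forall>e<k. 0 \<le> p e) \<and> (\<Sum>e<k. p e) = 1 \<and> (\<forall>e<k. norm (\<psi> e) = 1) \<and>
     \<rho> = (\<Sum>e<k. p e *\<^sub>R ketbra (\<psi> e) (\<psi> e))"

(* LEAST is the attained minimum, over finite ensembles of arbitrary size. *)
definition coherence_CF :: "(complex ^ 'n) set \<Rightarrow> complex ^ 'n ^ 'n \<Rightarrow> real" where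
  "coherence_CF B \<rho> =
     (LEAST v. v \<in> {\<Sum>e<k. p e * coherence_RE B (ketbra (\<psi> e) (\<psi> e)) | k p \<psi>.
                      pure_decomposition \<rho> k p \<psi>})"

end

theory Submission
  imports Defs "HOL-Real_Asymp.Real_Asymp"
begin

text \<open>
  For a qubit and an orthonormal basis \<open>{u, v}\<close>, the coherence of formation is
  \<open>f(|\<langle>u|\<rho>|v\<rangle>|)\<close> with \<open>f(t) = H((1 + \<surd>(1 - 4 t\<^sup>2)) / 2)\<close>: convexity and monotonicity of \<open>f\<close>
  give the lower bound, and mixing two pure states with the off-diagonal entry of \<open>\<rho>\<close> attains it.
  Write \<open>f(t) = H((1 - \<surd>(1 - 4 t\<^sup>2)) / 2)\<close>. Since \<open>H\<close> is subadditive and increasing on \<open>[0, 1/2]\<close>,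
  it suffices to add up the arguments of \<open>H\<close>. With \<open>R = 2 P - 1\<close> the squared length of the Bloch
  vector and \<open>a\<close>, \<open>b\<close> its components along the two measurement axes, this is the inequality
  \<open>\<surd>(1 - R + a\<^sup>2) + \<surd>(1 - R + b\<^sup>2) \<le> 1 + \<surd>(1 - 4 R \<surd>c (1 - \<surd>c))\<close>, which follows from
  \<open>a\<^sup>2 + b\<^sup>2 \<le> 2 c R\<close>; the latter is the positivity of a Gram determinant.
\<close>

subsection \<open>Binary entropy and the qubit coherence function\<close>

lemma binary_entropy_0 [simp]: "binary_entropy 0 = 0"
  by (simp add: binary_entropy_def)

lemma binary_entropy_sym: "binary_entropy (1 - q) = binary_entropy q"
  by (simp add: binary_entropy_def algebra_simps)

lemma binary_entropy_nonneg:
  assumes "0 \<le> q" "q \<le> 1"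
  shows "0 \<le> binary_entropy q"
proof -
  have "0 \<le> - x * log 2 x" if "0 \<le> x" "x \<le> 1" for x :: real
  proof (cases "x = 0")
    case False
    with that have "log 2 x \<le> 0" by simp
    with that show ?thesis by (simp add: mult_nonneg_nonpos)
  qed simp
  from this[of q] this[of "1 - q"] assms show ?thesis
    by (simp add: binary_entropy_def algebra_simps)
qed

lemma continuous_on_x_log: "continuous_on {0..} (\<lambda>x::real. x * log 2 x)"
proof -
  have "continuous (at x within {0..}) (\<lambda>x::real. x * log 2 x)" if "x \<ge> 0" for x
  proof (cases "x = 0")
    case True
    \<comment> \<open>At 0 the product is 0 whatever \<open>log 2 0\<close> is, so continuity there
      is just this one-sided limit.\<close>
    have "((\<lambda>x::real. x * log 2 x) \<longlongrightarrow> 0) (at_right 0)" by real_asymp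
    moreover have "at 0 within {0..} = at_right (0::real)"
      by (metis at_within_Ici_at_right)
    ultimately show ?thesis using True by (simp add: continuous_within)
  next
    case False
    with that show ?thesis by (intro continuous_intros) auto
  qed
  then show ?thesis by (simp add: continuous_on_eq_continuous_within)
qed

lemma continuous_on_binary_entropy: "continuous_on {0..1} binary_entropy"
proof -
  have *: "continuous_on {0..1} (\<lambda>x::real. x * log 2 x)"
    by (rule continuous_on_subset[OF continuous_on_x_log]) auto
  have "continuous_on {0..1} (\<lambda>x::real. (1 - x) * log 2 (1 - x))"
    by (rule continuous_on_compose2[OF *, where f = "\<lambda>x. 1 - x"]) (auto intro!: continuous_intros)
  with * have "continuous_on {0..1} (\<lambda>x::real. - (x * log 2 x) - (1 - x) * log 2 (1 - x))"
    by (intro continuous_on_diff continuous_on_minus)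
  then show ?thesis by (simp add: binary_entropy_def[abs_def])
qed

lemma binary_entropy_deriv:
  assumes "0 < q" "q < 1"
  shows "(binary_entropy has_real_derivative (ln (1 - q) - ln q) / ln 2) (at q)"
proof -
  have "(binary_entropy has_real_derivative
      (- 1 * (ln q / ln 2) + 1 / q / ln 2 * (- q)) -
      (- 1 * (ln (1 - q) / ln 2) + - 1 / (1 - q) / ln 2 * (1 - q))) (at q)"
    unfolding binary_entropy_def[abs_def] log_def using assms
    by (intro DERIV_diff DERIV_mult DERIV_cdivide) (auto intro!: derivative_eq_intros)
  moreover have "- 1 / (1 - q) / ln 2 * (1 - q) = - 1 / ln 2" "1 / q / ln 2 * (- q) = - 1 / ln 2"
    using assms by auto
  ultimately show ?thesis by (simp only:) (simp add: diff_divide_distrib)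
qed

text \<open>The derivative has the sign of ln (1 - x) - ln x. It blows up at 0, so it is used only
  on the open interval, with continuity covering the endpoints.\<close>

lemma binary_entropy_mono:
  assumes "0 \<le> a" "a \<le> b" "b \<le> 1/2"
  shows "binary_entropy a \<le> binary_entropy b"
proof (rule DERIV_nonneg_imp_increasing_open[OF \<open>a \<le> b\<close>])
  fix x assume "a < x" "x < b"
  with assms show "\<exists>y. (binary_entropy has_real_derivative y) (at x) \<and> 0 \<le> y"
    by (intro exI[of _ "(ln (1 - x) - ln x) / ln 2"]) (auto intro!: binary_entropy_deriv)
next
  show "continuous_on {a..b} binary_entropy"
    using assms by (intro continuous_on_subset[OF continuous_on_binary_entropy]) auto
qed

text \<open>Concavity: the derivative of the entropy decreases, so the gap H(x) - H(x + b) grows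
  with x. Comparing x = 0 and x = a, with H(0) = 0, gives the claim.\<close>

lemma binary_entropy_subadditive:
  assumes "0 \<le> a" "0 \<le> b" "a + b \<le> 1"
  shows "binary_entropy (a + b) \<le> binary_entropy a + binary_entropy b"
proof -
  let ?g = "\<lambda>x. binary_entropy x - binary_entropy (x + b)"
  have "?g 0 \<le> ?g a"
  proof (rule DERIV_nonneg_imp_increasing_open[OF \<open>0 \<le> a\<close>])
    fix x assume x: "0 < x" "x < a"
    have "(?g has_real_derivative (ln (1 - x) - ln x) / ln 2 - (ln (1 - (x + b)) - ln (x + b)) / ln 2) (at x)"
      using x assms binary_entropy_deriv[of "x + b"]
      by (intro DERIV_diff binary_entropy_deriv) (auto simp: DERIV_shift)
    moreover have "0 \<le> (ln (1 - x) - ln x) / ln 2 - (ln (1 - (x + b)) - ln (x + b)) / ln 2"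
      using x assms by (simp add: diff_divide_distrib[symmetric] add_mono diff_mono)
    ultimately show "\<exists>y. (?g has_real_derivative y) (at x) \<and> 0 \<le> y" by blast
  next
    show "continuous_on {0..a} ?g"
      using assms
      by (intro continuous_intros continuous_on_subset[OF continuous_on_binary_entropy]
            continuous_on_compose2[OF continuous_on_binary_entropy]) auto
  qed
  then show ?thesis by simp
qed

text \<open>Since a + b may exceed 1/2, where H decreases, monotonicity cannot be applied after
  subadditivity. Instead b is first cut down to d - a.\<close>

lemma binary_entropy_add_ge:
  assumes "0 \<le> a" "a \<le> 1/2" "0 \<le> b" "b \<le> 1/2" "0 \<le> d" "d \<le> 1/2" "d \<le> a + b"
  shows "binary_entropy d \<le> binary_entropy a + binary_entropy b"
proof (cases "d \<le> a")
  case True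
  with assms binary_entropy_mono[of d a] binary_entropy_nonneg[of b] show ?thesis by simp
next
  case False
  with assms binary_entropy_mono[of "d - a" b] binary_entropy_subadditive[of a "d - a"]
  show ?thesis by simp
qed

text \<open>For t in [0, 1/2] the argument of H is the larger root of q (1 - q) = t^2, so
  \<open>coh_fun t\<close> is the entropy of two probabilities whose geometric mean is t.\<close>

definition coh_fun :: "real \<Rightarrow> real" where
  "coh_fun t = binary_entropy ((1 + sqrt (1 - 4 * t\<^sup>2)) / 2)"

lemma four_sq_le_1: "0 \<le> t \<Longrightarrow> t \<le> 1/2 \<Longrightarrow> 4 * t\<^sup>2 \<le> (1::real)"
  using power_mono[of t "1/2" 2] by (simp add: power2_eq_square)

lemma coh_fun_alt: "coh_fun t = binary_entropy ((1 - sqrt (1 - 4 * t\<^sup>2)) / 2)"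
proof -
  have "(1 - sqrt (1 - 4 * t\<^sup>2)) / 2 = 1 - (1 + sqrt (1 - 4 * t\<^sup>2)) / 2"
    by (simp add: field_simps)
  then show ?thesis by (metis coh_fun_def binary_entropy_sym)
qed

lemma coh_fun_0 [simp]: "coh_fun 0 = 0"
  by (simp add: coh_fun_alt)

lemma coh_fun_half [simp]: "coh_fun (1/2) = 1"
proof -
  have "log 2 (1/2::real) = -1" by (simp add: log_divide)
  then show ?thesis by (simp add: coh_fun_def binary_entropy_def power2_eq_square)
qed

lemma coh_fun_nonneg:
  assumes "0 \<le> t" "t \<le> 1/2"
  shows "0 \<le> coh_fun t"
proof -
  have "sqrt (1 - 4 * t\<^sup>2) \<le> 1" "0 \<le> sqrt (1 - 4 * t\<^sup>2)"
    using four_sq_le_1[OF assms] by auto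
  then show ?thesis unfolding coh_fun_def by (intro binary_entropy_nonneg) auto
qed

lemma coh_fun_prod_sqrt:
  assumes "0 \<le> q" "q \<le> 1"
  shows "coh_fun (sqrt q * sqrt (1 - q)) = binary_entropy q"
proof -
  have "1 - 4 * (sqrt q * sqrt (1 - q))\<^sup>2 = (2 * q - 1)\<^sup>2"
    using assms by (simp add: power_mult_distrib) (simp add: power2_eq_square algebra_simps)
  then have "sqrt (1 - 4 * (sqrt q * sqrt (1 - q))\<^sup>2) = \<bar>2 * q - 1\<bar>" by simp
  moreover have "(1 + (1 - 2 * q)) / 2 = 1 - q" "(1 + (2 * q - 1)) / 2 = q"
    by (simp_all add: field_simps)
  ultimately show ?thesis unfolding coh_fun_def by (metis abs_if binary_entropy_sym minus_diff_eq)
qed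

text \<open>The right side is twice the inverse hyperbolic tangent of s. The inequality supplies the
  sign of the derivative of \<open>coh_slope\<close>.\<close>

lemma two_mult_le_ln_diff:
  assumes "0 \<le> s" "s < (1::real)"
  shows "2 * s \<le> ln (1 + s) - ln (1 - s)"
proof -
  let ?g = "\<lambda>s::real. ln (1 + s) - ln (1 - s) - 2 * s"
  have "?g 0 \<le> ?g s"
  proof (rule DERIV_nonneg_imp_nondecreasing[OF \<open>0 \<le> s\<close>])
    fix x :: real assume x: "0 \<le> x" "x \<le> s"
    have "(?g has_real_derivative 2 * x\<^sup>2 / (1 - x\<^sup>2)) (at x)"
      using x assms abs_square_less_1[of x]
      by (auto intro!: derivative_eq_intros simp: field_simps power2_eq_square)
    moreover have "0 \<le> 2 * x\<^sup>2 / (1 - x\<^sup>2)"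
      using x assms abs_square_less_1[of x] by auto
    ultimately show "\<exists>y. (?g has_real_derivative y) (at x) \<and> 0 \<le> y" by blast
  qed
  then show ?thesis by simp
qed

text \<open>Up to the factor 1 / ln 2, this is the derivative of \<open>coh_fun\<close> in the
  variable s = sqrt (1 - 4 t^2), for which sqrt (1 - s^2) = 2 t.\<close>

definition coh_slope :: "real \<Rightarrow> real" where
  "coh_slope s = sqrt (1 - s\<^sup>2) / s * (ln (1 + s) - ln (1 - s))"

text \<open>This is the convexity of \<open>coh_fun\<close> in disguise: s decreases as t grows, so
  a slope decreasing in s increases in t.\<close>

lemma coh_slope_antimono:
  assumes "0 < s" "s \<le> s'" "s' < 1"
  shows "coh_slope s' \<le> coh_slope s"
proof (rule DERIV_nonpos_imp_nonincreasing[OF \<open>s \<le> s'\<close>])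
  fix x assume x: "s \<le> x" "x \<le> s'"
  then have pos: "0 < x" "x < 1" using assms by auto
  then have x2: "x\<^sup>2 < 1" using abs_square_less_1[of x] by auto
  define w where "w = sqrt (1 - x\<^sup>2)"
  have w: "w > 0" "w * w = 1 - x\<^sup>2" using x2 by (auto simp: w_def)
  have nz: "1 - x \<noteq> 0" "1 + x \<noteq> 0" "x \<noteq> 0" "w \<noteq> 0" using pos w by auto
  let ?L = "ln (1 + x) - ln (1 - x)"
  \<comment> \<open>The product rule leaves two terms, which w^2 = 1 - x^2 collapses to - L / (x^2
    w) and 2 / (x w). The sign of their sum is then that of 2 x - L.\<close>
  have eq: "((- x / w) * x - w) / (x * x) * ?L + w / x * (1 / (1 + x) + 1 / (1 - x))
      = (2 * x - ?L) / (x\<^sup>2 * w)" (is "?lhs = _")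
  proof -
    have "(- x / w) * x - w = - (x\<^sup>2 + w * w) / w"
      using nz by (simp add: field_simps power2_eq_square)
    then have "(- x / w) * x - w = - 1 / w" unfolding w(2) by simp
    moreover have "1 / (1 + x) + 1 / (1 - x) = 2 / (w * w)"
      using nz unfolding w(2) by (simp add: field_simps power2_eq_square)
    ultimately have "?lhs = (- 1 / w) / (x * x) * ?L + w / x * (2 / (w * w))"
      by (simp only:)
    then show ?thesis using nz by (simp add: field_simps power2_eq_square)
  qed
  have "(coh_slope has_real_derivative
      ((- x / w) * x - w) / (x * x) * ?L + w / x * (1 / (1 + x) + 1 / (1 - x))) (at x)"
  proof -
    have "((\<lambda>s. sqrt (1 - s\<^sup>2)) has_real_derivative - x / w) (at x)"
      unfolding w_def using x2 by (auto intro!: derivative_eq_intros simp: divide_simps)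
    from DERIV_divide[OF this DERIV_ident]
    have "((\<lambda>s. sqrt (1 - s\<^sup>2) / s) has_real_derivative ((- x / w) * x - w) / (x * x)) (at x)"
      using pos by (simp add: w_def)
    moreover have "((\<lambda>s. ln (1 + s) - ln (1 - s)) has_real_derivative 1 / (1 + x) + 1 / (1 - x)) (at x)"
      using pos by (auto intro!: derivative_eq_intros)
    ultimately show ?thesis
      unfolding coh_slope_def[abs_def] using DERIV_mult by (fastforce simp: w_def algebra_simps)
  qed
  moreover have "(2 * x - ?L) / (x\<^sup>2 * w) \<le> 0"
    using two_mult_le_ln_diff[of x] pos w by (intro divide_nonpos_pos) auto
  ultimately show "\<exists>y. (coh_slope has_real_derivative y) (at x) \<and> y \<le> 0"
    unfolding eq by blast
qed

lemma continuous_on_coh_fun: "continuous_on {0..1/2} coh_fun"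
  unfolding coh_fun_def[abs_def]
  by (rule continuous_on_compose2[OF continuous_on_binary_entropy])
     (auto intro!: continuous_intros simp: four_sq_le_1)

lemma sqrt_1_minus_four_sq_bounds:
  assumes "0 < t" "t < (1/2::real)"
  shows "0 < sqrt (1 - 4 * t\<^sup>2)" "sqrt (1 - 4 * t\<^sup>2) < 1"
proof -
  have "4 * t\<^sup>2 < 1" using assms power_strict_mono[of t "1/2" 2] by (simp add: power2_eq_square)
  then show "0 < sqrt (1 - 4 * t\<^sup>2)" "sqrt (1 - 4 * t\<^sup>2) < 1" using assms by auto
qed

lemma coh_fun_deriv:
  assumes "0 < t" "t < 1/2"
  shows "(coh_fun has_real_derivative coh_slope (sqrt (1 - 4 * t\<^sup>2)) / ln 2) (at t)"
proof -
  define s where "s = sqrt (1 - 4 * t\<^sup>2)"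
  have s: "0 < s" "s < 1" using sqrt_1_minus_four_sq_bounds[OF assms] by (auto simp: s_def)
  then have *: "1 - 4 * t\<^sup>2 > 0" unfolding s_def by simp
  have "sqrt (1 - s\<^sup>2) = sqrt ((2 * t)\<^sup>2)"
    unfolding s_def using * by (simp add: power_mult_distrib)
  also have "\<dots> = 2 * t" using assms by (subst real_sqrt_abs) simp
  finally have w: "sqrt (1 - s\<^sup>2) = 2 * t" .
  have d: "((\<lambda>t. (1 + sqrt (1 - 4 * t\<^sup>2)) / 2) has_real_derivative - 2 * t / s) (at t)"
    unfolding s_def using * by (auto intro!: derivative_eq_intros simp: divide_simps)
  have "(coh_fun has_real_derivative
      (ln (1 - (1 + s) / 2) - ln ((1 + s) / 2)) / ln 2 * (- 2 * t / s)) (at t)"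
    unfolding coh_fun_def[abs_def]
    by (rule DERIV_chain2[OF _ d]) (use s in \<open>auto simp: s_def[symmetric] intro!: binary_entropy_deriv\<close>)
  moreover have "ln (1 - (1 + s) / 2) - ln ((1 + s) / 2) = ln (1 - s) - ln (1 + s)"
  proof -
    have "1 - (1 + s) / 2 = (1 - s) / 2" by argo
    moreover have "ln ((1 - s) / 2) = ln (1 - s) - ln 2" "ln ((1 + s) / 2) = ln (1 + s) - ln 2"
      using s ln_div[of "1 - s" 2] ln_div[of "1 + s" 2] by auto
    ultimately show ?thesis by (simp only:)
  qed
  moreover have "(ln (1 - s) - ln (1 + s)) / ln 2 * (- 2 * t / s) = coh_slope s / ln 2"
    unfolding coh_slope_def w by (simp add: divide_inverse algebra_simps)
  ultimately show ?thesis by (simp add: s_def)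
qed

text \<open>A supporting line, obtained from the mean value theorem and the monotone derivative. Its
  slope is nonnegative so that convexity and monotonicity can be used together. At 0 the derivative
  formula breaks down and slope 0 serves; at 1/2 the formula would divide by s = 0.\<close>

lemma coh_fun_tangent:
  assumes "0 \<le> t0" "t0 < 1/2"
  obtains m where "0 \<le> m"
    and "\<And>t. 0 \<le> t \<Longrightarrow> t \<le> 1/2 \<Longrightarrow> coh_fun t0 + m * (t - t0) \<le> coh_fun t"
proof (cases "t0 = 0")
  case True
  then show ?thesis using that[of 0] coh_fun_nonneg by simp
next
  case False
  with assms have t0: "0 < t0" "t0 < 1/2" by auto
  define D where "D t = coh_slope (sqrt (1 - 4 * t\<^sup>2)) / ln 2" for t
  have D: "(coh_fun has_real_derivative D t) (at t)" if "0 < t" "t < 1/2" for t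
    using coh_fun_deriv[OF that] by (simp add: D_def)
  have diff: "coh_fun differentiable (at t)" if "0 < t" "t < 1/2" for t
    using D[OF that] by (auto simp: real_differentiable_def)
  have mono: "D t \<le> D t'" if "0 < t" "t \<le> t'" "t' < 1/2" for t t'
    using that sqrt_1_minus_four_sq_bounds[of t] sqrt_1_minus_four_sq_bounds[of t']
    unfolding D_def by (intro divide_right_mono coh_slope_antimono) auto
  have nonneg: "0 \<le> D t0"
  proof -
    let ?s = "sqrt (1 - 4 * t0\<^sup>2)"
    have s: "0 < ?s" "?s < 1" using sqrt_1_minus_four_sq_bounds t0 by auto
    then have "?s\<^sup>2 \<le> 1" by (intro power_le_one) auto
    moreover have "0 \<le> ln (1 + ?s) - ln (1 - ?s)"
      using s two_mult_le_ln_diff[of ?s] by linarith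
    ultimately show ?thesis using s
      unfolding D_def coh_slope_def
      by (intro divide_nonneg_nonneg mult_nonneg_nonneg) auto
  qed
  have "coh_fun t0 + D t0 * (t - t0) \<le> coh_fun t" if t: "0 \<le> t" "t \<le> 1/2" for t
  proof -
    consider "t < t0" | "t = t0" | "t0 < t" by linarith
    then show ?thesis
    proof cases
      case 1
      have "\<exists>l z. t < z \<and> z < t0 \<and> (coh_fun has_real_derivative l) (at z) \<and>
          coh_fun t0 - coh_fun t = (t0 - t) * l"
        using t t0 1 D
        by (intro MVT continuous_on_subset[OF continuous_on_coh_fun] diff) auto
      then obtain l z where z: "t < z" "z < t0" "(coh_fun has_real_derivative l) (at z)"
          "coh_fun t0 - coh_fun t = (t0 - t) * l" by blast
      then have "l = D z" using DERIV_unique D[of z] t t0 by force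
      with z mono[of z t0] t t0 have "l \<le> D t0" by simp
      then have "(t0 - t) * l \<le> (t0 - t) * D t0" using 1 by (intro mult_left_mono) auto
      with z(4) show ?thesis by (simp add: algebra_simps)
    next
      case 3
      have "\<exists>l z. t0 < z \<and> z < t \<and> (coh_fun has_real_derivative l) (at z) \<and>
          coh_fun t - coh_fun t0 = (t - t0) * l"
        using t t0 3 D
        by (intro MVT continuous_on_subset[OF continuous_on_coh_fun] diff) auto
      then obtain l z where z: "t0 < z" "z < t" "(coh_fun has_real_derivative l) (at z)"
          "coh_fun t - coh_fun t0 = (t - t0) * l" by blast
      then have "l = D z" using DERIV_unique D[of z] t t0 by force
      with z mono[of t0 z] t t0 have "D t0 \<le> l" by simp
      then have "(t - t0) * D t0 \<le> (t - t0) * l" using 3 by (intro mult_left_mono) auto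
      with z(4) show ?thesis by (simp add: algebra_simps)
    qed simp
  qed
  with nonneg show ?thesis by (rule that)
qed

text \<open>Only an inequality between \<open>t0\<close> and the mean is assumed, because
  \<open>t0\<close> will come from a triangle inequality. The slope of the supporting line at
  \<open>t0\<close> being nonnegative absorbs the difference.\<close>

lemma coh_fun_Jensen:
  fixes p t :: "nat \<Rightarrow> real"
  assumes p: "\<And>e. e < k \<Longrightarrow> 0 \<le> p e" "(\<Sum>e<k. p e) = 1"
    and t: "\<And>e. e < k \<Longrightarrow> 0 \<le> t e \<and> t e \<le> 1/2"
    and t0: "0 \<le> t0" "t0 \<le> (\<Sum>e<k. p e * t e)"
  shows "coh_fun t0 \<le> (\<Sum>e<k. p e * coh_fun (t e))"
proof (cases "t0 < 1/2")
  case True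
  obtain m where m: "0 \<le> m" "\<And>t. 0 \<le> t \<Longrightarrow> t \<le> 1/2 \<Longrightarrow> coh_fun t0 + m * (t - t0) \<le> coh_fun t"
    using coh_fun_tangent[OF t0(1) True] by blast
  have "coh_fun t0 \<le> coh_fun t0 + m * ((\<Sum>e<k. p e * t e) - t0)"
    using m(1) t0(2) by simp
  also have "\<dots> = (\<Sum>e<k. p e * (coh_fun t0 - m * t0)) + (\<Sum>e<k. m * (p e * t e))"
    unfolding sum_distrib_right[symmetric] sum_distrib_left[symmetric] p(2)
    by (simp add: algebra_simps)
  also have "\<dots> = (\<Sum>e<k. p e * (coh_fun t0 + m * (t e - t0)))"
    by (simp add: sum.distrib[symmetric] algebra_simps)
  also have "\<dots> \<le> (\<Sum>e<k. p e * coh_fun (t e))"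
    using p t m(2) by (intro sum_mono mult_left_mono) auto
  finally show ?thesis .
next
  case False
  \<comment> \<open>Here the mean reaches the maximal value 1/2, which forces
    \<open>t e = 1/2\<close> wherever the weight is positive.\<close>
  have "(\<Sum>e<k. p e * (1/2 - t e)) = 1/2 - (\<Sum>e<k. p e * t e)"
    by (simp add: right_diff_distrib sum_subtractf p(2) sum_distrib_right[symmetric] sum_divide_distrib[symmetric])
  moreover have nn: "0 \<le> p e * (1/2 - t e)" if "e < k" for e using p t that by simp
  moreover have "0 \<le> (\<Sum>e<k. p e * (1/2 - t e))" using nn by (intro sum_nonneg) auto
  ultimately have "(\<Sum>e<k. p e * (1/2 - t e)) = 0" and half: "t0 = 1/2"
    using False t0 by auto
  then have "p e * (1/2 - t e) = 0" if "e < k" for e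
    using sum_nonneg_eq_0_iff[of "{..<k}" "\<lambda>e. p e * (1/2 - t e)"] nn that by simp
  then have "p e * coh_fun (t e) = p e" if "e < k" for e
    using that by (metis coh_fun_half eq_iff_diff_eq_0 mult_cancel_left mult.right_neutral no_zero_divisors)
  then have "(\<Sum>e<k. p e * coh_fun (t e)) = (\<Sum>e<k. p e)" by (intro sum.cong) auto
  then have "(\<Sum>e<k. p e * coh_fun (t e)) = 1" using p(2) by simp
  then show ?thesis unfolding half coh_fun_half by simp
qed


section \<open>Real inequalities behind the bound: square roots, Gram determinant, mixing
  weights\<close>

lemma sqrt_sum_le:
  assumes R: "0 \<le> R" "R \<le> 1" and s: "1/2 \<le> s" "s \<le> (1::real)"
    and ab: "a\<^sup>2 + b\<^sup>2 \<le> 2 * s\<^sup>2 * R"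
  shows "sqrt (1 - R + a\<^sup>2) + sqrt (1 - R + b\<^sup>2) \<le> 1 + sqrt (1 - 4 * R * s * (1 - s))"
proof -
  let ?x = "sqrt (1 - R + a\<^sup>2)" and ?y = "sqrt (1 - R + b\<^sup>2)"
  let ?k = "sqrt (1 - 4 * R * s * (1 - s))"
  have k0: "0 \<le> 1 - 4 * R * s * (1 - s)"
  proof -
    have "R * (1 - (2 * s - 1)\<^sup>2) \<le> 1 * 1"
      using R s by (intro mult_mono) (auto simp: power_le_one)
    then show ?thesis by (simp add: power2_eq_square algebra_simps)
  qed
  have x: "?x\<^sup>2 = 1 - R + a\<^sup>2" and y: "?y\<^sup>2 = 1 - R + b\<^sup>2" and k: "?k\<^sup>2 = 1 - 4 * R * s * (1 - s)"
    using R k0 by auto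
  \<comment> \<open>The difference of the two sides is 4 R (1 - s)^2 (1 - R).\<close>
  have "(1 - 2 * R * (1 - s))\<^sup>2 \<le> ?k\<^sup>2"
  proof -
    have "0 \<le> 4 * R * (1 - s) * ((1 - s) * (1 - R))" using R s by simp
    then show ?thesis unfolding k by (simp add: power2_eq_square algebra_simps)
  qed
  then have le_k: "1 - 2 * R * (1 - s) \<le> ?k" by (rule power2_le_imp_le) (use k0 in simp)
  have "(?x + ?y)\<^sup>2 \<le> 2 * (?x\<^sup>2 + ?y\<^sup>2)"
    using zero_le_power2[of "?x - ?y"] by (simp add: power2_eq_square algebra_simps)
  \<comment> \<open>The hypothesis gives the bound 4 - 4 R (1 - s^2). Writing 1 - s^2 = (1 - s) + s
    (1 - s) separates a part bounded through k from a part that is k^2 - 1.\<close>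
  also have "\<dots> \<le> 2 + 2 * (1 - 2 * R * (1 - s)) - 4 * R * s * (1 - s)"
    unfolding x y using ab by (simp add: power2_eq_square algebra_simps)
  also have "\<dots> \<le> 1 + 2 * ?k + ?k\<^sup>2"
    unfolding k using le_k by simp
  also have "\<dots> = (1 + ?k)\<^sup>2" by (simp add: power2_eq_square algebra_simps)
  finally show ?thesis by (rule power2_le_imp_le) (use k0 in simp)
qed

lemma coh_fun_sum_ge:
  assumes R: "0 \<le> R" "R \<le> 1" and c: "1/2 \<le> c" "c \<le> 1"
    and u: "4 * u\<^sup>2 = R - a\<^sup>2" and v: "4 * v\<^sup>2 = R - b\<^sup>2"
    and ab: "a\<^sup>2 + b\<^sup>2 \<le> 2 * c * R"
  shows "binary_entropy ((1 + sqrt (1 - 4 * R * sqrt c * (1 - sqrt c))) / 2) \<le> coh_fun u + coh_fun v"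
proof -
  define s where "s = sqrt c"
  have s: "s\<^sup>2 = c" "s \<le> 1" "1/2 \<le> s"
    using c real_le_rsqrt[of "1/2" c] by (auto simp: s_def power2_eq_square)
  have R0: "R - a\<^sup>2 \<ge> 0" "R - b\<^sup>2 \<ge> 0" unfolding u[symmetric] v[symmetric] by auto
  let ?x = "sqrt (1 - R + a\<^sup>2)" and ?y = "sqrt (1 - R + b\<^sup>2)"
  let ?k = "sqrt (1 - 4 * R * s * (1 - s))"
  have eq: "1 - 4 * u\<^sup>2 = 1 - R + a\<^sup>2" "1 - 4 * v\<^sup>2 = 1 - R + b\<^sup>2"
    using u v by auto
  have le: "?x + ?y \<le> 1 + ?k"
    using sqrt_sum_le[of R s a b] R s ab by simp
  have xy: "0 \<le> ?x" "?x \<le> 1" "0 \<le> ?y" "?y \<le> 1" using R R0 by auto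
  have "0 \<le> R * s * (1 - s)" using R s by simp
  moreover have "R * (1 - (2 * s - 1)\<^sup>2) \<le> 1 * 1"
    using R s by (intro mult_mono) (auto simp: power_le_one)
  ultimately have k: "0 \<le> ?k" "?k \<le> 1" by (auto simp: power2_eq_square algebra_simps)
  \<comment> \<open>The bound x + y <= 1 + k says exactly that (1 - k) / 2 is at most the sum of the
    other two arguments, and all three lie in [0, 1/2].\<close>
  have "binary_entropy ((1 - ?k) / 2) \<le> binary_entropy ((1 - ?x) / 2) + binary_entropy ((1 - ?y) / 2)"
    using le xy k by (intro binary_entropy_add_ge) (auto simp: field_simps)
  moreover have "binary_entropy ((1 - ?k) / 2) = binary_entropy ((1 + ?k) / 2)"
    using binary_entropy_sym[of "(1 + ?k) / 2"] by (simp add: field_simps)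
  ultimately show ?thesis unfolding coh_fun_alt eq s_def by simp
qed

text \<open>The Gram determinant of r, n, m is a squared triple product. For unit n, m this gives
  a^2 + b^2 <= R (1 - g^2) + 2 a b g; bounding 2 a b g by |g| (a^2 + b^2) and cancelling 1 - |g|
  finishes. If |g| = 1, Cauchy-Schwarz suffices.\<close>

lemma Gram_bound:
  fixes n1 n2 n3 m1 m2 m3 r1 r2 r3 :: real
  assumes n: "n1\<^sup>2 + n2\<^sup>2 + n3\<^sup>2 = 1" and m: "m1\<^sup>2 + m2\<^sup>2 + m3\<^sup>2 = 1"
    and R: "R = r1\<^sup>2 + r2\<^sup>2 + r3\<^sup>2" and g: "g = n1 * m1 + n2 * m2 + n3 * m3"
    and a: "a = r1 * n1 + r2 * n2 + r3 * n3" and b: "b = r1 * m1 + r2 * m2 + r3 * m3"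
  shows "a\<^sup>2 + b\<^sup>2 \<le> R * (1 + \<bar>g\<bar>)"
proof -
  have CS: "(x1 * y1 + x2 * y2 + x3 * y3)\<^sup>2 \<le> (x1\<^sup>2 + x2\<^sup>2 + x3\<^sup>2) * (y1\<^sup>2 + y2\<^sup>2 + y3\<^sup>2)"
    for x1 x2 x3 y1 y2 y3 :: real
  proof -
    have "0 \<le> (x1 * y2 - x2 * y1)\<^sup>2 + (x1 * y3 - x3 * y1)\<^sup>2 + (x2 * y3 - x3 * y2)\<^sup>2" by simp
    then show ?thesis by (simp add: power2_eq_square algebra_simps)
  qed
  have a2: "a\<^sup>2 \<le> R" and b2: "b\<^sup>2 \<le> R" and "g\<^sup>2 \<le> 1"
    using CS[of r1 n1 r2 n2 r3 n3] CS[of r1 m1 r2 m2 r3 m3] CS[of n1 m1 n2 m2 n3 m3]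
    unfolding a b R g n m by simp_all
  then have g1: "\<bar>g\<bar> \<le> 1" by (simp add: abs_square_le_1)
  show ?thesis
  proof (cases "\<bar>g\<bar> = 1")
    case True
    with a2 b2 show ?thesis by simp
  next
    case False
    \<comment> \<open>Keeping the squared lengths symbolic makes the determinant formula a
      polynomial identity; they become 1 only afterwards.\<close>
    define N where "N = n1\<^sup>2 + n2\<^sup>2 + n3\<^sup>2"
    define M where "M = m1\<^sup>2 + m2\<^sup>2 + m3\<^sup>2"
    have "R * N * M + 2 * a * b * g - R * g\<^sup>2 - M * a\<^sup>2 - N * b\<^sup>2
        = (r1 * (n2 * m3 - n3 * m2) - r2 * (n1 * m3 - n3 * m1) + r3 * (n1 * m2 - n2 * m1))\<^sup>2"
      unfolding R a b g N_def M_def by algebra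
    then have "0 \<le> R * N * M + 2 * a * b * g - R * g\<^sup>2 - M * a\<^sup>2 - N * b\<^sup>2" by simp
    then have gram: "a\<^sup>2 + b\<^sup>2 \<le> R * (1 - g\<^sup>2) + 2 * (a * b) * g"
      unfolding N_def M_def n m by (simp add: algebra_simps)
    have "2 * \<bar>a * b\<bar> \<le> a\<^sup>2 + b\<^sup>2"
      using zero_le_power2[of "\<bar>a\<bar> - \<bar>b\<bar>"] by (simp add: power2_diff abs_mult)
    then have "2 * \<bar>a * b\<bar> * \<bar>g\<bar> \<le> (a\<^sup>2 + b\<^sup>2) * \<bar>g\<bar>" by (intro mult_right_mono) auto
    moreover have "2 * (a * b) * g \<le> 2 * \<bar>a * b\<bar> * \<bar>g\<bar>"
      using abs_ge_self[of "2 * (a * b) * g"] by (simp add: abs_mult)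
    moreover have "g\<^sup>2 = \<bar>g\<bar> * \<bar>g\<bar>" by (simp add: power2_eq_square)
    ultimately have "(1 - \<bar>g\<bar>) * (a\<^sup>2 + b\<^sup>2) \<le> (1 - \<bar>g\<bar>) * (R * (1 + \<bar>g\<bar>))"
      using gram by (simp add: algebra_simps)
    moreover have "0 < 1 - \<bar>g\<bar>" using False g1 by linarith
    ultimately show ?thesis by (simp only: mult_le_cancel_left_pos)
  qed
qed

text \<open>Prepares the optimal ensemble: two pure states with populations q and 1 - q share the
  coherence modulus r, and their mixture has population p. Such a mixture exists because the
  hypothesis on r places p between 1 - q and q.\<close>

lemma mixing_weights:
  fixes p r :: real
  assumes "0 \<le> r" "r\<^sup>2 \<le> p * (1 - p)"
  obtains q l where "0 \<le> q" "q \<le> 1" "sqrt q * sqrt (1 - q) = r"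
    and "0 \<le> l" "l \<le> 1" "l * q + (1 - l) * (1 - q) = p"
proof -
  define s where "s = sqrt (1 - 4 * r\<^sup>2)"
  have "(2 * p - 1)\<^sup>2 \<le> 1 - 4 * r\<^sup>2"
    using assms by (simp add: power2_eq_square algebra_simps)
  moreover from this have r4: "4 * r\<^sup>2 \<le> 1"
    using zero_le_power2[of "2 * p - 1"] by linarith
  ultimately have ps: "\<bar>2 * p - 1\<bar> \<le> s"
    unfolding s_def by (intro real_le_rsqrt) simp
  have s: "0 \<le> s" "s \<le> 1" "s\<^sup>2 = 1 - 4 * r\<^sup>2" using r4 by (auto simp: s_def)
  let ?q = "(1 + s) / 2"
  have "?q * (1 - ?q) = r\<^sup>2" using s(3) by (simp add: power2_eq_square field_simps)
  then have q: "sqrt ?q * sqrt (1 - ?q) = r"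
    using assms(1) by (simp add: real_sqrt_mult[symmetric])
  show ?thesis
  proof (cases "s = 0")
    case True
    with ps have "p = 1/2" by linarith
    with True show ?thesis using that[of "1/2" 1] q by auto
  next
    case False
    \<comment> \<open>With 2 q - 1 = s, the mixing equation reads (2 l - 1) s = 2 p - 1.\<close>
    let ?l = "(1 + (2 * p - 1) / s) / 2"
    have "\<bar>(2 * p - 1) / s\<bar> \<le> 1" using ps s False by simp
    then have "-1 \<le> (2 * p - 1) / s" "(2 * p - 1) / s \<le> 1" unfolding abs_le_iff by linarith+
    then have "0 \<le> ?l" "?l \<le> 1" by auto
    moreover have "?l * ?q + (1 - ?l) * (1 - ?q) = p" using False by (simp add: field_simps)
    moreover have "0 \<le> ?q" "?q \<le> 1" using s by auto
    ultimately show ?thesis using that[of ?q ?l] q by blast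
  qed
qed

subsection \<open>Orthonormal pairs and entropies\<close>

text \<open>Any diagonalization computes the entropy: \<open>spectral_fun_rel_unique\<close> settles
  the definite description, and cyclicity of the trace removes U.\<close>

lemma vn_entropy_spectral:
  fixes U :: "complex ^ 'n ^ 'n"
  assumes "unitary U" and A: "A = U ** real_diag d ** dagger U"
  shows "vn_entropy A = - (\<Sum>i\<in>UNIV. d i * log 2 (d i))"
proof -
  let ?L = "real_diag (\<lambda>i. log 2 (d i)) :: complex ^ 'n ^ 'n"
  have UU: "dagger U ** U = mat 1" using assms(1) by (simp add: unitary_def)
  have rel: "spectral_fun_rel (log 2) A (U ** ?L ** dagger U)"
    unfolding spectral_fun_rel_def by (intro exI[of _ U] exI[of _ d] conjI assms refl)
  have sp: "spectral_fun (log 2) A = U ** ?L ** dagger U"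
    unfolding spectral_fun_def
    by (rule the_equality, rule rel) (rule spectral_fun_rel_unique[OF _ rel])
  have "A ** spectral_fun (log 2) A = U ** real_diag d ** (dagger U ** U) ** ?L ** dagger U"
    unfolding sp unfolding A by (simp only: matrix_mul_assoc)
  also have "\<dots> = U ** (real_diag d ** ?L ** dagger U)"
    by (simp only: UU matrix_mul_rid matrix_mul_assoc)
  finally have "trace (A ** spectral_fun (log 2) A) = trace (real_diag d ** ?L ** dagger U ** U)"
    by (simp only: trace_mul_sym[of U])
  also have "\<dots> = trace (real_diag d ** ?L ** (dagger U ** U))"
    by (simp only: matrix_mul_assoc)
  also have "\<dots> = trace (real_diag d ** ?L)"
    by (simp only: UU matrix_mul_rid)
  also have "\<dots> = (\<Sum>i\<in>UNIV. complex_of_real (d i * log 2 (d i)))"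
    unfolding trace_def
  proof (rule sum.cong)
    fix i :: 'n
    have "(real_diag d ** ?L) $ i $ i
        = (\<Sum>k\<in>UNIV. if k = i then complex_of_real (d i * log 2 (d i)) else 0)"
      unfolding matrix_matrix_mult_def vec_lambda_beta by (rule sum.cong) (auto simp: real_diag_def)
    then show "(real_diag d ** ?L) $ i $ i = complex_of_real (d i * log 2 (d i))" by simp
  qed simp
  finally show ?thesis unfolding vn_entropy_def by (simp only: of_real_sum[symmetric] Re_complex_of_real)
qed

section \<open>Algebra of the sesquilinear form and of rank-one matrices\<close>

lemma cinner_add_left: "cinner (u + v) w = cinner u w + cinner v w"
  by (simp add: cinner_def distrib_right sum.distrib)

lemma cinner_add_right: "cinner u (v + w) = cinner u v + cinner u w"
  by (simp add: cinner_def distrib_left sum.distrib)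

lemma cinner_scale_left: "cinner (k *s u) v = cnj k * cinner u v"
  by (simp add: cinner_def sum_distrib_left mult.assoc)

lemma cinner_scale_right: "cinner u (k *s v) = k * cinner u v"
  by (simp add: cinner_def sum_distrib_left mult.left_commute)

lemma cinner_scaleR_right: "cinner u (k *\<^sub>R v) = complex_of_real k * cinner u v"
  by (simp add: cinner_def sum_distrib_left mult.left_commute scaleR_conv_of_real[where 'a = complex])

lemma cinner_sum_right: "cinner u (\<Sum>e\<in>E. f e) = (\<Sum>e\<in>E. cinner u (f e))"
  unfolding cinner_def sum_component sum_distrib_left by (rule sum.swap)

lemma cinner_commute: "cinner v u = cnj (cinner u v)"
  by (simp add: cinner_def mult.commute)

lemma cinner_self: "cinner v v = complex_of_real ((norm v)\<^sup>2)"
proof -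
  have "(norm v)\<^sup>2 = (\<Sum>i\<in>UNIV. (cmod (v $ i))\<^sup>2)"
    by (simp add: norm_vec_def L2_set_def sum_nonneg)
  moreover have "cnj x * x = complex_of_real ((cmod x)\<^sup>2)" for x
    unfolding complex_norm_square by (rule mult.commute)
  ultimately show ?thesis unfolding cinner_def by (simp only: of_real_sum)
qed

lemma cinner_dagger: "cinner (A *v u) v = cinner u (dagger A *v v)"
proof -
  have "cinner (A *v u) v = (\<Sum>i\<in>UNIV. \<Sum>j\<in>UNIV. cnj (u $ j) * (cnj (A $ i $ j) * v $ i))"
    unfolding cinner_def matrix_vector_mult_def vec_lambda_beta cnj_sum sum_distrib_right
    by (intro sum.cong refl) simp
  also have "\<dots> = (\<Sum>j\<in>UNIV. \<Sum>i\<in>UNIV. cnj (u $ j) * (cnj (A $ i $ j) * v $ i))"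
    by (rule sum.swap)
  also have "\<dots> = cinner u (dagger A *v v)"
    unfolding cinner_def matrix_vector_mult_def dagger_def vec_lambda_beta sum_distrib_left ..
  finally show ?thesis .
qed

lemma ketbra_mult_vec: "ketbra u v *v w = cinner v w *s u"
  unfolding ketbra_def cinner_def matrix_vector_mult_def vec_eq_iff
    vector_smult_component vec_lambda_beta sum_distrib_right
  by (intro allI sum.cong refl) simp

lemma scaleR_matrix_mult_vec:
  fixes A :: "complex ^ 'n ^ 'm"
  shows "(k *\<^sub>R A) *v w = k *\<^sub>R (A *v w)"
  by (simp add: vec_eq_iff matrix_vector_mult_def scaleR_sum_right)

lemma sum_scaleR_matrix_mult_vec:
  fixes K :: "'e \<Rightarrow> complex ^ 'n ^ 'n"
  shows "(\<Sum>e\<in>E. p e *\<^sub>R K e) *v w = (\<Sum>e\<in>E. p e *\<^sub>R (K e *v w))"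
proof -
  have "(\<Sum>j\<in>UNIV. (\<Sum>e\<in>E. p e *\<^sub>R K e $ i $ j) * w $ j)
      = (\<Sum>e\<in>E. p e *\<^sub>R (\<Sum>j\<in>UNIV. K e $ i $ j * w $ j))" for i
    unfolding sum_distrib_right scaleR_sum_right mult_scaleR_left by (rule sum.swap)
  then show ?thesis by (simp add: vec_eq_iff matrix_vector_mult_def)
qed

section \<open>Ordered orthonormal pairs as coordinates\<close>

definition onb_pair :: "complex ^ 2 \<Rightarrow> complex ^ 2 \<Rightarrow> bool" where
  "onb_pair a b \<longleftrightarrow> cinner a a = 1 \<and> cinner b b = 1 \<and> cinner a b = 0"

lemma onb_pairD:
  assumes "onb_pair a b"
  shows "cinner a a = 1" "cinner b b = 1" "cinner a b = 0" "cinner b a = 0"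
  using assms cinner_commute[of b a] by (auto simp: onb_pair_def)

lemma norm_onb_pair:
  assumes "onb_pair a b"
  shows "norm a = 1" "norm b = 1"
proof -
  have "norm v = 1" if "cinner v v = 1" for v :: "complex ^ 2"
    using that norm_ge_zero[of v] unfolding cinner_self of_real_eq_1_iff power2_eq_1_iff by linarith
  then show "norm a = 1" "norm b = 1" using onb_pairD[OF assms] by auto
qed

lemma onb_pair_neq: "onb_pair a b \<Longrightarrow> a \<noteq> b"
  by (auto simp: onb_pair_def)

text \<open>Pairing a vanishing combination with one of its vectors shows independence. Together
  with spanning, this makes the cardinality equal to the dimension 2.\<close>

lemma orthonormal_basis_pair:
  fixes B :: "(complex ^ 2) set"
  assumes "orthonormal_basis B"
  obtains a b where "B = {a, b}" "onb_pair a b"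
proof -
  have on: "cinner u v = (if u = v then 1 else 0)" if "u \<in> B" "v \<in> B" for u v
    using assms that by (auto simp: orthonormal_basis_def)
  have "vec.independent B"
    unfolding vec.independent_explicit_module
  proof (intro allI impI)
    fix T f and v :: "complex ^ 2"
    assume T: "finite T" "T \<subseteq> B" "(\<Sum>w\<in>T. f w *s w) = 0" "v \<in> T"
    have "0 = cinner v (\<Sum>w\<in>T. f w *s w)" unfolding T(3) by (simp add: cinner_def)
    also have "\<dots> = (\<Sum>w\<in>T. f w * cinner v w)" by (simp add: cinner_sum_right cinner_scale_right)
    also have "\<dots> = (\<Sum>w\<in>T. if v = w then f w else 0)"
      using T by (intro sum.cong) (auto simp: on subset_iff)
    also have "\<dots> = f v" using T by simp
    finally show "f v = 0" by simp
  qed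
  then have "card B = 2"
    using assms vec.dim_span_eq_card_independent[of B] vec_dim_card[where 'a = complex and 'n = 2]
    by (simp add: orthonormal_basis_def)
  then obtain a b where ab: "B = {a, b}" "a \<noteq> b" by (auto simp: card_2_iff)
  then have "onb_pair a b" using on by (auto simp: onb_pair_def)
  with ab that show ?thesis by blast
qed

definition col_pair :: "complex ^ 2 \<Rightarrow> complex ^ 2 \<Rightarrow> complex ^ 2 ^ 2" where
  "col_pair a b = (\<chi> i j. if j = 1 then a $ i else b $ i)"

lemma dagger_col_pair_mult:
  "(dagger (col_pair a b) ** A ** col_pair a b) $ i $ j
    = cinner (if i = 1 then a else b) (A *v (if j = 1 then a else b))"
  unfolding matrix_mul_assoc[symmetric]
  by (simp add: matrix_matrix_mult_def matrix_vector_mult_def cinner_def dagger_def col_pair_def)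

lemma unitary_col_pair:
  assumes "onb_pair a b"
  shows "unitary (col_pair a b)"
proof -
  have "dagger (col_pair a b) ** col_pair a b = mat 1"
  proof -
    \<comment> \<open>The identity is inserted so that the formula for matrix entries in the basis
      applies.\<close>
    have "(dagger (col_pair a b) ** mat 1 ** col_pair a b) $ i $ j = mat 1 $ i $ j" for i j :: 2
      unfolding dagger_col_pair_mult matrix_vector_mul_lid using onb_pairD[OF assms] exhaust_2[of i] exhaust_2[of j]
      by (auto simp: mat_def)
    then show ?thesis by (simp add: vec_eq_iff)
  qed
  then show ?thesis by (simp add: unitary_def matrix_left_right_inverse)
qed

text \<open>The four numbers are the entries after conjugation by the unitary with columns a and b,
  and conjugating back recovers the matrix.\<close>

lemma matrix_eqI_onb_pair:
  fixes A B :: "complex ^ 2 ^ 2"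
  assumes ab: "onb_pair a b"
    and "cinner a (A *v a) = cinner a (B *v a)" "cinner a (A *v b) = cinner a (B *v b)"
    and "cinner b (A *v a) = cinner b (B *v a)" "cinner b (A *v b) = cinner b (B *v b)"
  shows "A = B"
proof -
  let ?U = "col_pair a b"
  have "dagger ?U ** A ** ?U = dagger ?U ** B ** ?U"
    by (simp add: vec_eq_iff dagger_col_pair_mult assms)
  moreover have "?U ** (dagger ?U ** M ** ?U) ** dagger ?U = M" for M :: "complex ^ 2 ^ 2"
  proof -
    have "?U ** (dagger ?U ** M ** ?U) ** dagger ?U = (?U ** dagger ?U) ** M ** (?U ** dagger ?U)"
      by (simp only: matrix_mul_assoc)
    then show ?thesis
      using unitary_col_pair[OF ab] by (simp add: unitary_def)
  qed
  ultimately show ?thesis by metis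
qed

lemma trace_onb_pair:
  assumes "onb_pair a b"
  shows "trace A = cinner a (A *v a) + cinner b (A *v b)"
proof -
  let ?U = "col_pair a b"
  have "trace (dagger ?U ** A ** ?U) = trace (?U ** (dagger ?U ** A))"
    by (rule trace_mul_sym)
  also have "\<dots> = trace ((?U ** dagger ?U) ** A)"
    by (simp only: matrix_mul_assoc)
  finally have "trace A = trace (dagger ?U ** A ** ?U)"
    using unitary_col_pair[OF assms] by (simp add: unitary_def)
  then show ?thesis by (simp add: trace_def sum_2 dagger_col_pair_mult)
qed

lemma vec_onb_pair_expand:
  assumes "onb_pair a b"
  shows "v = cinner a v *s a + cinner b v *s b"
proof -
  have "ketbra a a + ketbra b b = mat 1"
    by (rule matrix_eqI_onb_pair[OF assms])
       (simp_all add: matrix_vector_mult_add_rdistrib ketbra_mult_vec onb_pairD[OF assms]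
          cinner_add_right cinner_scale_right)
  then have "v = (ketbra a a + ketbra b b) *v v" by simp
  then show ?thesis by (simp add: matrix_vector_mult_add_rdistrib ketbra_mult_vec)
qed

lemma cinner_onb_pair:
  assumes "onb_pair a b"
  shows "cinner u v = cinner u a * cinner a v + cinner u b * cinner b v"
  by (subst vec_onb_pair_expand[OF assms, of v]) (simp add: cinner_add_right cinner_scale_right mult.commute)

lemma Parseval_onb_pair:
  assumes "onb_pair a b"
  shows "(cmod (cinner a v))\<^sup>2 + (cmod (cinner b v))\<^sup>2 = (norm v)\<^sup>2"
proof -
  have "complex_of_real ((norm v)\<^sup>2) = cnj (cinner a v) * cinner a v + cnj (cinner b v) * cinner b v"
    unfolding cinner_self[symmetric] using cinner_onb_pair[OF assms, of v v] cinner_commute by metis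
  also have "\<dots> = complex_of_real ((cmod (cinner a v))\<^sup>2 + (cmod (cinner b v))\<^sup>2)"
    by (simp only: complex_norm_square of_real_add mult.commute)
  finally show ?thesis by (simp only: of_real_eq_iff)
qed

section \<open>Entropy and coherence of pure states\<close>

lemma vn_entropy_onb_pair:
  assumes "onb_pair a b"
  shows "vn_entropy (p *\<^sub>R ketbra a a + q *\<^sub>R ketbra b b) = - p * log 2 p - q * log 2 q"
proof -
  let ?U = "col_pair a b"
  have "p *\<^sub>R ketbra a a + q *\<^sub>R ketbra b b
      = ?U ** real_diag (\<lambda>i. if i = 1 then p else q) ** dagger ?U"
    by (simp add: vec_eq_iff forall_2 matrix_matrix_mult_def sum_2 real_diag_def dagger_def
          col_pair_def ketbra_def scaleR_conv_of_real[where 'a = complex] mult_ac)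
  from vn_entropy_spectral[OF unitary_col_pair[OF assms] this] show ?thesis
    by (simp add: sum_2)
qed

lemma vn_entropy_pure:
  fixes \<psi> :: "complex ^ 2"
  assumes "norm \<psi> = 1"
  shows "vn_entropy (ketbra \<psi> \<psi>) = 0"
proof -
  \<comment> \<open>A unit vector orthogonal to \<open>\<psi>\<close>, which exhibits the pure state
    as diagonal with eigenvalues 1 and 0.\<close>
  define \<phi> :: "complex ^ 2" where "\<phi> = (\<chi> i. if i = 1 then - cnj (\<psi> $ 2) else cnj (\<psi> $ 1))"
  have "cinner \<psi> \<psi> = 1" using assms by (simp add: cinner_self)
  moreover from this have "cinner \<phi> \<phi> = 1"
    by (simp add: cinner_def sum_2 \<phi>_def mult.commute add.commute)
  moreover have "cinner \<psi> \<phi> = 0" by (simp add: cinner_def sum_2 \<phi>_def)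
  ultimately have "onb_pair \<psi> \<phi>" by (simp add: onb_pair_def)
  from vn_entropy_onb_pair[OF this, of 1 0] show ?thesis by simp
qed

lemma diag_part_pure:
  assumes "onb_pair a b"
  shows "diag_part {a, b} (ketbra \<psi> \<psi>)
    = (cmod (cinner a \<psi>))\<^sup>2 *\<^sub>R ketbra a a + (cmod (cinner b \<psi>))\<^sup>2 *\<^sub>R ketbra b b"
proof -
  have *: "cinner u (ketbra \<psi> \<psi> *v u) = complex_of_real ((cmod (cinner u \<psi>))\<^sup>2)" for u
    unfolding ketbra_mult_vec cinner_scale_right complex_norm_square
    by (simp add: cinner_commute[of \<psi>] mult.commute)
  show ?thesis using onb_pair_neq[OF assms]
    unfolding diag_part_def by (simp add: * vec_eq_iff scaleR_conv_of_real[where 'a = complex])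
qed

text \<open>A pure state has zero entropy, so only the entropy of its populations q and 1 - q
  remains. The product of the amplitude moduli is sqrt (q (1 - q)), the argument at which
  \<open>coh_fun\<close> returns H(q).\<close>

lemma coherence_RE_pure:
  assumes ab: "onb_pair a b" and "norm \<psi> = 1"
  shows "coherence_RE {a, b} (ketbra \<psi> \<psi>) = coh_fun (cmod (cinner a \<psi>) * cmod (cinner b \<psi>))"
proof -
  let ?q = "(cmod (cinner a \<psi>))\<^sup>2"
  have q: "(cmod (cinner b \<psi>))\<^sup>2 = 1 - ?q"
    using Parseval_onb_pair[OF ab, of \<psi>] assms(2) by simp
  then have q1: "?q \<le> 1" using zero_le_power2[of "cmod (cinner b \<psi>)"] by linarith
  have "sqrt (1 - ?q) = cmod (cinner b \<psi>)" unfolding q[symmetric] by simp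
  then have "coh_fun (cmod (cinner a \<psi>) * cmod (cinner b \<psi>)) = binary_entropy ?q"
    using coh_fun_prod_sqrt[of ?q] q1 by simp
  then show ?thesis
    unfolding coherence_RE_def diag_part_pure[OF ab] vn_entropy_onb_pair[OF ab] vn_entropy_pure[OF assms(2)]
    by (simp add: q binary_entropy_def)
qed

lemma cinner_decomposition:
  assumes "pure_decomposition \<rho> k p \<psi>"
  shows "cinner u (\<rho> *v v) = (\<Sum>e<k. p e * (cinner u (\<psi> e) * cinner (\<psi> e) v))"
proof -
  have \<rho>: "\<rho> = (\<Sum>e<k. p e *\<^sub>R ketbra (\<psi> e) (\<psi> e))"
    using assms unfolding pure_decomposition_def by (elim conjE)
  have "cinner u (p e *\<^sub>R (ketbra (\<psi> e) (\<psi> e) *v v)) = p e * (cinner u (\<psi> e) * cinner (\<psi> e) v)" for e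
    unfolding cinner_scaleR_right ketbra_mult_vec cinner_scale_right
    by (simp only: mult.commute[of "cinner (\<psi> e) v"])
  then show ?thesis
    unfolding \<rho> sum_scaleR_matrix_mult_vec cinner_sum_right by (intro sum.cong refl)
qed

text \<open>The entries of a density operator in a basis. The last bound says that the determinant
  is nonnegative.\<close>

lemma density_onb_pair:
  fixes \<rho> :: "complex ^ 2 ^ 2"
  assumes "density_operator \<rho>" and ab: "onb_pair a b"
  obtains p where "cinner a (\<rho> *v a) = complex_of_real p" "cinner b (\<rho> *v b) = complex_of_real (1 - p)"
    and "cinner b (\<rho> *v a) = cnj (cinner a (\<rho> *v b))"
    and "0 \<le> p" "p \<le> 1" "(cmod (cinner a (\<rho> *v b)))\<^sup>2 \<le> p * (1 - p)"
proof -
  have herm: "dagger \<rho> = \<rho>" and pos: "\<And>v. 0 \<le> Re (cinner v (\<rho> *v v))" and tr: "trace \<rho> = 1"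
    using assms(1) by (auto simp: density_operator_def)
  have sym: "cinner u (\<rho> *v v) = cnj (cinner v (\<rho> *v u))" for u v
    by (metis cinner_commute cinner_dagger herm)
  define p where "p = Re (cinner a (\<rho> *v a))"
  define q where "q = Re (cinner b (\<rho> *v b))"
  define w where "w = cinner a (\<rho> *v b)"
  have p: "cinner a (\<rho> *v a) = complex_of_real p" and q: "cinner b (\<rho> *v b) = complex_of_real q"
    using arg_cong[OF sym[of a a], of Im] arg_cong[OF sym[of b b], of Im]
    by (simp_all add: p_def q_def complex_eq_iff)
  have w': "cinner b (\<rho> *v a) = cnj w" using sym[of b a] by (simp add: w_def)
  have "complex_of_real (p + q) = 1" using trace_onb_pair[OF ab, of \<rho>] tr p q by simp
  then have "p + q = 1" by (simp only: of_real_eq_1_iff)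
  then have q1: "q = 1 - p" by linarith
  have p0: "0 \<le> p" and q0: "0 \<le> q" using pos by (auto simp: p_def q_def)
  define r where "r = (cmod w)\<^sup>2"
  have r0: "r \<ge> 0" and ww: "Re w * Re w + Im w * Im w = r"
    unfolding r_def cmod_power2 by (simp_all add: power2_eq_square)
  have form: "0 \<le> s * s * r * p + t * t * q - 2 * s * t * r" for s t
  proof -
    \<comment> \<open>The factor w cancels the phase of the off-diagonal entry, so the quadratic
      form depends on w only through r = |w|^2.\<close>
    let ?v = "(complex_of_real (- s) * w) *s a + complex_of_real t *s b"
    have "0 \<le> Re (cinner ?v (\<rho> *v ?v))" by (rule pos)
    also have "\<dots> = s * s * (Re w * Re w + Im w * Im w) * p + t * t * q
        - 2 * s * t * (Re w * Re w + Im w * Im w)"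
    proof -
      let ?s = "complex_of_real s" and ?t = "complex_of_real t"
      have form: "cinner ?v (\<rho> *v ?v) = ?s * ?s * (cnj w * w) * complex_of_real p + ?t * ?t * complex_of_real q
          - ?s * ?t * (cnj w * w) - ?s * ?t * (cnj w * w)"
        unfolding matrix_vector_right_distrib vector_scalar_commute cinner_add_left cinner_add_right
          cinner_scale_left cinner_scale_right p q w' w_def[symmetric]
        by (simp add: algebra_simps)
      show ?thesis unfolding form by (simp add: algebra_simps)
    qed
    finally show ?thesis unfolding ww .
  qed
  \<comment> \<open>Taking s = 1, t = p gives p (p q - r) >= 0. If p = 0 then q = 1, and s = 1, t =
    r gives - r^2 >= 0.\<close>
  have "r \<le> p * q"
  proof (cases "p = 0")
    case True
    with q1 form[of 1 r] have "r * r \<le> 0" by simp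
    then have "r = 0" using r0 mult_pos_pos[of r r] by linarith
    then show ?thesis using True by simp
  next
    case False
    with form[of 1 p] have "0 \<le> p * (p * q - r)" by (simp add: algebra_simps)
    moreover have "0 < p" using False p0 by simp
    ultimately have "0 \<le> p * q - r" by (simp only: zero_le_mult_iff) linarith
    then show ?thesis by simp
  qed
  then have "(cmod (cinner a (\<rho> *v b)))\<^sup>2 \<le> p * (1 - p)"
    by (simp only: r_def w_def q1)
  moreover have "p \<le> 1" using q0 q1 by simp
  ultimately show ?thesis
    by (rule that[OF p q[unfolded q1] w'[unfolded w_def] p0, rotated])
qed

subsection \<open>Coherence of formation of a qubit\<close>

lemma cmod_prod_le_half:
  assumes "onb_pair a b" "norm \<psi> = 1"
  shows "cmod (cinner a \<psi>) * cmod (cinner b \<psi>) \<le> 1/2"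
  using Parseval_onb_pair[OF assms(1), of \<psi>] assms(2)
    zero_le_power2[of "cmod (cinner a \<psi>) - cmod (cinner b \<psi>)"]
  by (simp add: power2_diff)

text \<open>The off-diagonal entry of \<open>\<rho>\<close> is the average of those of the ensemble
  members. The triangle inequality bounds its modulus by the average modulus, and Jensen's
  inequality concludes.\<close>

lemma coherence_CF_lower:
  assumes ab: "onb_pair a b" and dec: "pure_decomposition \<rho> k p \<psi>"
  shows "coh_fun (cmod (cinner a (\<rho> *v b)))
    \<le> (\<Sum>e<k. p e * coherence_RE {a, b} (ketbra (\<psi> e) (\<psi> e)))"
proof -
  let ?t = "\<lambda>e. cmod (cinner a (\<psi> e)) * cmod (cinner b (\<psi> e))"
  have p: "\<And>e. e < k \<Longrightarrow> 0 \<le> p e" "(\<Sum>e<k. p e) = 1" and n: "\<And>e. e < k \<Longrightarrow> norm (\<psi> e) = 1"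
    using dec by (auto simp: pure_decomposition_def)
  have "cmod (cinner a (\<rho> *v b)) \<le> (\<Sum>e<k. cmod (p e * (cinner a (\<psi> e) * cinner (\<psi> e) b)))"
    unfolding cinner_decomposition[OF dec] by (rule norm_sum)
  also have "\<dots> = (\<Sum>e<k. p e * ?t e)"
    using p(1) by (intro sum.cong) (auto simp: norm_mult cinner_commute[of "\<psi> _" b])
  finally have "coh_fun (cmod (cinner a (\<rho> *v b))) \<le> (\<Sum>e<k. p e * coh_fun (?t e))"
    using p cmod_prod_le_half[OF ab] n by (intro coh_fun_Jensen) auto
  also have "\<dots> = (\<Sum>e<k. p e * coherence_RE {a, b} (ketbra (\<psi> e) (\<psi> e)))"
    using coherence_RE_pure[OF ab] n by (intro sum.cong) auto
  finally show ?thesis .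
qed

text \<open>Both members of the ensemble have the very off-diagonal entry w of
  \<open>\<rho>\<close>, hence the same coherence. The weights l and 1 - l only have to match the
  diagonal.\<close>

lemma coherence_CF_attained:
  assumes \<rho>: "density_operator \<rho>" and ab: "onb_pair a b"
  obtains k p \<psi> where "pure_decomposition \<rho> k p \<psi>"
    and "(\<Sum>e<k. p e * coherence_RE {a, b} (ketbra (\<psi> e) (\<psi> e))) = coh_fun (cmod (cinner a (\<rho> *v b)))"
proof -
  define w where "w = cinner a (\<rho> *v b)"
  obtain d where d: "cinner a (\<rho> *v a) = complex_of_real d" "cinner b (\<rho> *v b) = complex_of_real (1 - d)"
      "cinner b (\<rho> *v a) = cnj w" "(cmod w)\<^sup>2 \<le> d * (1 - d)"
    using density_onb_pair[OF \<rho> ab] unfolding w_def by metis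
  obtain q l where q: "0 \<le> q" "q \<le> 1" "sqrt q * sqrt (1 - q) = cmod w"
      and l: "0 \<le> l" "l \<le> 1" "l * q + (1 - l) * (1 - q) = d"
    using mixing_weights[OF norm_ge_zero d(4)] by metis
  \<comment> \<open>The phase of w, set to 1 if w = 0.\<close>
  obtain \<omega> where \<omega>: "cmod \<omega> = 1" "w = complex_of_real (cmod w) * \<omega>"
  proof (cases "w = 0")
    case False
    then have "w = complex_of_real (cmod w) * sgn w" by (simp add: sgn_eq)
    with False show ?thesis using that[of "sgn w"] by (simp add: norm_sgn)
  qed (use that[of 1] in simp)
  have \<omega>\<omega>: "\<omega> * cnj \<omega> = 1" using \<omega>(1) complex_norm_square[of \<omega>] by simp
  define \<phi> where "\<phi> x = complex_of_real (sqrt x) *s a + (complex_of_real (sqrt (1 - x)) * cnj \<omega>) *s b" for x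
  have \<phi>a: "cinner a (\<phi> x) = complex_of_real (sqrt x)"
    and \<phi>b: "cinner b (\<phi> x) = complex_of_real (sqrt (1 - x)) * cnj \<omega>" for x
    by (simp_all add: \<phi>_def cinner_add_right cinner_scale_right onb_pairD[OF ab])
  have a\<phi>: "cinner (\<phi> x) a = complex_of_real (sqrt x)"
    and b\<phi>: "cinner (\<phi> x) b = complex_of_real (sqrt (1 - x)) * \<omega>" for x
    using cinner_commute[of "\<phi> x" a] cinner_commute[of "\<phi> x" b] \<phi>a[of x] \<phi>b[of x] by simp_all
  have norm\<phi>: "norm (\<phi> x) = 1" if "0 \<le> x" "x \<le> 1" for x
  proof -
    have "(norm (\<phi> x))\<^sup>2 = 1"
      unfolding Parseval_onb_pair[OF ab, symmetric] \<phi>a \<phi>b using that \<omega>(1) by (simp add: norm_mult)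
    then show ?thesis by (simp add: power2_eq_1_iff) (use norm_ge_zero[of "\<phi> x"] in linarith)
  qed
  have coh\<phi>: "coherence_RE {a, b} (ketbra (\<phi> x) (\<phi> x)) = coh_fun (sqrt x * sqrt (1 - x))"
    if "0 \<le> x" "x \<le> 1" for x
    unfolding coherence_RE_pure[OF ab norm\<phi>[OF that]] \<phi>a \<phi>b using that \<omega>(1) by (simp add: norm_mult)
  define p :: "nat \<Rightarrow> real" where "p e = (if e = 0 then l else 1 - l)" for e
  define \<psi> :: "nat \<Rightarrow> complex ^ 2" where "\<psi> e = \<phi> (if e = 0 then q else 1 - q)" for e
  have two: "(\<Sum>e<2. f e) = f 0 + f (Suc 0)" for f :: "nat \<Rightarrow> 'x::comm_monoid_add"
    by (simp add: numeral_2_eq_2)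
  have sq: "complex_of_real (sqrt x) * complex_of_real (sqrt x) = complex_of_real x" if "0 \<le> x" for x
    using that by (simp flip: of_real_mult)
  have sq': "complex_of_real (sqrt q) * complex_of_real (sqrt (1 - q)) = complex_of_real (cmod w)"
    unfolding q(3)[symmetric] by simp
  have "\<rho> = l *\<^sub>R ketbra (\<phi> q) (\<phi> q) + (1 - l) *\<^sub>R ketbra (\<phi> (1 - q)) (\<phi> (1 - q))" (is "_ = ?\<sigma>")
  proof -
    have mel: "cinner u (?\<sigma> *v v) = complex_of_real l * (cinner u (\<phi> q) * cinner (\<phi> q) v)
        + complex_of_real (1 - l) * (cinner u (\<phi> (1 - q)) * cinner (\<phi> (1 - q)) v)" for u v
      by (simp add: matrix_vector_mult_add_rdistrib cinner_add_right scaleR_matrix_mult_vec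
            cinner_scaleR_right ketbra_mult_vec cinner_scale_right mult_ac)
    show ?thesis
    proof (rule matrix_eqI_onb_pair[OF ab])
      show "cinner a (\<rho> *v a) = cinner a (?\<sigma> *v a)"
        unfolding mel \<phi>a a\<phi> d(1) l(3)[symmetric] using q by (simp add: sq)
      show "cinner b (\<rho> *v b) = cinner b (?\<sigma> *v b)"
      proof -
        have "cinner b (?\<sigma> *v b) = complex_of_real l * (complex_of_real (1 - q) * (\<omega> * cnj \<omega>))
            + complex_of_real (1 - l) * (complex_of_real q * (\<omega> * cnj \<omega>))"
          unfolding mel \<phi>b b\<phi> using sq[of q] sq[of "1 - q"] q(1,2) by (simp add: mult_ac)
        then show ?thesis unfolding \<omega>\<omega> d(2) l(3)[symmetric] by (simp add: algebra_simps)
      qed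
      \<comment> \<open>Splits w according to the weights, so that each summand matches the
        off-diagonal entry of one member.\<close>
      have wl: "w = complex_of_real l * (complex_of_real (cmod w) * \<omega>)
          + complex_of_real (1 - l) * (complex_of_real (cmod w) * \<omega>)"
        unfolding \<omega>(2)[symmetric] by (simp add: algebra_simps)
      show "cinner a (\<rho> *v b) = cinner a (?\<sigma> *v b)"
        unfolding w_def[symmetric] mel \<phi>a b\<phi>
        by (subst wl) (simp add: sq'[symmetric] mult_ac)
      show "cinner b (\<rho> *v a) = cinner b (?\<sigma> *v a)"
        unfolding d(3) mel \<phi>b a\<phi>
        by (subst wl) (simp add: sq'[symmetric] mult_ac)
    qed
  qed
  then have "pure_decomposition \<rho> 2 p \<psi>"
    using l q norm\<phi> by (auto simp: pure_decomposition_def two p_def \<psi>_def)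
  moreover have "(\<Sum>e<2. p e * coherence_RE {a, b} (ketbra (\<psi> e) (\<psi> e))) = coh_fun (cmod w)"
    using q coh\<phi>[of q] coh\<phi>[of "1 - q"]
    by (simp add: two p_def \<psi>_def mult.commute[of "sqrt (1 - q)"] algebra_simps)
  ultimately show ?thesis using that by (simp add: w_def)
qed

lemma coherence_CF_qubit:
  assumes "density_operator \<rho>" and "onb_pair a b"
  shows "coherence_CF {a, b} \<rho> = coh_fun (cmod (cinner a (\<rho> *v b)))"
  unfolding coherence_CF_def
proof (rule Least_equality)
  obtain k p \<psi> where dec: "pure_decomposition \<rho> k p \<psi>"
      and val: "(\<Sum>e<k. p e * coherence_RE {a, b} (ketbra (\<psi> e) (\<psi> e))) = coh_fun (cmod (cinner a (\<rho> *v b)))"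
    using coherence_CF_attained[OF assms] by metis
  show "coh_fun (cmod (cinner a (\<rho> *v b)))
      \<in> {\<Sum>e<k. p e * coherence_RE {a, b} (ketbra (\<psi> e) (\<psi> e)) | k p \<psi>. pure_decomposition \<rho> k p \<psi>}"
    unfolding mem_Collect_eq using dec val[symmetric] by (intro exI[of _ k] exI[of _ p] exI[of _ \<psi>] conjI)
qed (use coherence_CF_lower[OF assms(2)] in auto)

section \<open>Purity, Bloch components and overlaps\<close>

lemma trace_square_onb_pair:
  fixes \<rho> :: "complex ^ 2 ^ 2"
  assumes "density_operator \<rho>" and ab: "onb_pair a b"
  shows "4 * (cmod (cinner a (\<rho> *v b)))\<^sup>2
    = 2 * Re (trace (\<rho> ** \<rho>)) - 1 - (2 * Re (cinner a (\<rho> *v a)) - 1)\<^sup>2"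
proof -
  define w where "w = cinner a (\<rho> *v b)"
  obtain p where p: "cinner a (\<rho> *v a) = complex_of_real p" "cinner b (\<rho> *v b) = complex_of_real (1 - p)"
      "cinner b (\<rho> *v a) = cnj w"
    using density_onb_pair[OF assms] unfolding w_def by metis
  have herm: "dagger \<rho> = \<rho>" using assms(1) by (simp add: density_operator_def)
  have "cinner u ((\<rho> ** \<rho>) *v v) = cinner u (\<rho> *v a) * cinner a (\<rho> *v v) + cinner u (\<rho> *v b) * cinner b (\<rho> *v v)" for u v
    using cinner_onb_pair[OF ab, of "\<rho> *v u" "\<rho> *v v"]
    by (simp add: matrix_vector_mul_assoc[symmetric] cinner_dagger herm)
  then have "trace (\<rho> ** \<rho>) = complex_of_real p * complex_of_real p + w * cnj w
      + (cnj w * w + complex_of_real (1 - p) * complex_of_real (1 - p))"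
    by (simp add: trace_onb_pair[OF ab] p w_def[symmetric])
  \<comment> \<open>Since 2 (p^2 + (1 - p)^2) - 1 = (2 p - 1)^2, the squared Bloch length splits
    into an axial part (2 p - 1)^2 and a transversal part 4 |w|^2.\<close>
  then have "Re (trace (\<rho> ** \<rho>)) = p\<^sup>2 + (1 - p)\<^sup>2 + 2 * (cmod w)\<^sup>2"
    unfolding cmod_power2 by (simp add: power2_eq_square)
  then show ?thesis unfolding p w_def[symmetric] by (simp add: power2_eq_square algebra_simps)
qed

text \<open>In Bloch coordinates \<open>r\<close>, \<open>n\<close>, \<open>m\<close> of \<open>\<rho>\<close>, \<open>x\<close>, \<open>z\<close> one has
  \<open>\<langle>x|\<rho>|x\<rangle> = (1 + r \<bullet> n) / 2\<close>, \<open>|\<langle>x|z\<rangle>|\<^sup>2 = (1 + n \<bullet> m) / 2\<close>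
  and \<open>Tr \<rho>\<^sup>2 = (1 + |r|\<^sup>2) / 2\<close>.\<close>

lemma qubit_expectation_bound:
  fixes \<rho> :: "complex ^ 2 ^ 2"
  assumes "density_operator \<rho>" and "norm x = 1" "norm z = 1"
  shows "(2 * Re (cinner x (\<rho> *v x)) - 1)\<^sup>2 + (2 * Re (cinner z (\<rho> *v z)) - 1)\<^sup>2
    \<le> (2 * Re (trace (\<rho> ** \<rho>)) - 1) * (1 + \<bar>2 * (cmod (cinner x z))\<^sup>2 - 1\<bar>)"
proof -
  define p where "p = Re (\<rho> $ 1 $ 1)"
  define s t where "s = Re (\<rho> $ 1 $ 2)" and "t = Im (\<rho> $ 1 $ 2)"
  have herm: "cnj (\<rho> $ j $ i) = \<rho> $ i $ j" for i j
    using assms(1) by (auto simp: density_operator_def dagger_def vec_eq_iff)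
  have e12: "\<rho> $ 1 $ 2 = Complex s t" and e21: "\<rho> $ 2 $ 1 = Complex s (- t)"
    using herm[of 1 2] by (simp_all add: s_def t_def complex_eq_iff)
  have e11: "\<rho> $ 1 $ 1 = Complex p 0"
    using herm[of 1 1] by (simp add: p_def complex_eq_iff)
  have e22: "\<rho> $ 2 $ 2 = Complex (1 - p) 0"
    using assms(1) e11 by (simp add: density_operator_def trace_def sum_2 complex_eq_iff)
  \<comment> \<open>The expectations of the three Pauli matrices in v. The Bloch vector of
    \<open>\<rho>\<close> itself is (2 s, - 2 t, 2 p - 1).\<close>
  define n1 n2 n3 where "n1 v = 2 * (Re (v $ 1) * Re (v $ 2) + Im (v $ 1) * Im (v $ 2))"
    and "n2 v = 2 * (Re (v $ 1) * Im (v $ 2) - Im (v $ 1) * Re (v $ 2))"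
    and "n3 v = (Re (v $ 1))\<^sup>2 + (Im (v $ 1))\<^sup>2 - (Re (v $ 2))\<^sup>2 - (Im (v $ 2))\<^sup>2" for v :: "complex ^ 2"
  note n_defs = n1_def n2_def n3_def
  have unit: "(Re (v $ 1))\<^sup>2 + (Im (v $ 1))\<^sup>2 + (Re (v $ 2))\<^sup>2 + (Im (v $ 2))\<^sup>2 = 1"
    if "norm v = 1" for v :: "complex ^ 2"
    using that by (simp add: norm_vec_def L2_set_def sum_2 cmod_power2)
  have nn: "(n1 v)\<^sup>2 + (n2 v)\<^sup>2 + (n3 v)\<^sup>2 = 1" if "norm v = 1" for v
  proof -
    have "(n1 v)\<^sup>2 + (n2 v)\<^sup>2 + (n3 v)\<^sup>2
        = ((Re (v $ 1))\<^sup>2 + (Im (v $ 1))\<^sup>2 + (Re (v $ 2))\<^sup>2 + (Im (v $ 2))\<^sup>2)\<^sup>2"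
      unfolding n_defs by algebra
    then show ?thesis using unit[OF that] by simp
  qed
  have expect: "2 * Re (cinner v (\<rho> *v v)) - 1 = (2 * s) * n1 v + (- 2 * t) * n2 v + (2 * p - 1) * n3 v"
    if "norm v = 1" for v
  proof -
    \<comment> \<open>Replacing 1 by the squared norm of v gives a polynomial identity valid for all
      v. The overlap formula further down is homogenized in the same way.\<close>
    have "2 * Re (cinner v (\<rho> *v v))
        - ((Re (v $ 1))\<^sup>2 + (Im (v $ 1))\<^sup>2 + (Re (v $ 2))\<^sup>2 + (Im (v $ 2))\<^sup>2)
        = (2 * s) * n1 v + (- 2 * t) * n2 v + (2 * p - 1) * n3 v"
      unfolding n_defs
      by (simp add: cinner_def matrix_vector_mult_def sum_2 e11 e12 e21 e22 power2_eq_square algebra_simps)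
    then show ?thesis using unit[OF that] by simp
  qed
  have P: "2 * Re (trace (\<rho> ** \<rho>)) - 1 = (2 * s)\<^sup>2 + (- 2 * t)\<^sup>2 + (2 * p - 1)\<^sup>2"
    by (simp add: trace_def matrix_matrix_mult_def sum_2 e11 e12 e21 e22 power2_eq_square algebra_simps)
  have "2 * (cmod (cinner x z))\<^sup>2
      - ((Re (x $ 1))\<^sup>2 + (Im (x $ 1))\<^sup>2 + (Re (x $ 2))\<^sup>2 + (Im (x $ 2))\<^sup>2)
       * ((Re (z $ 1))\<^sup>2 + (Im (z $ 1))\<^sup>2 + (Re (z $ 2))\<^sup>2 + (Im (z $ 2))\<^sup>2)
      = n1 x * n1 z + n2 x * n2 z + n3 x * n3 z"
    unfolding n_defs cmod_power2
    by (simp add: cinner_def sum_2 power2_eq_square algebra_simps)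
  then have ov: "2 * (cmod (cinner x z))\<^sup>2 - 1 = n1 x * n1 z + n2 x * n2 z + n3 x * n3 z"
    using unit assms by simp
  show ?thesis
    by (rule Gram_bound[OF nn[OF assms(2)] nn[OF assms(3)] P ov expect[OF assms(2)] expect[OF assms(3)]])
qed

text \<open>The four squared overlaps form a doubly stochastic 2 x 2 matrix, so only v and 1 - v
  occur, and the larger of them is (1 + |2 v - 1|) / 2.\<close>

lemma Max_overlap_onb_pair:
  assumes x: "onb_pair x0 x1" and z: "onb_pair z0 z1"
    and c: "c = Max {(cmod (cinner x z))\<^sup>2 | x z. x \<in> {x0, x1} \<and> z \<in> {z0, z1}}"
  shows "c = (1 + \<bar>2 * (cmod (cinner x0 z0))\<^sup>2 - 1\<bar>) / 2"
proof -
  let ?v = "(cmod (cinner x0 z0))\<^sup>2"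
  have sym: "cmod (cinner u v) = cmod (cinner v u)" for u v :: "complex ^ 2"
    by (subst cinner_commute) simp
  have 1: "(cmod (cinner x1 z0))\<^sup>2 = 1 - ?v"
    using Parseval_onb_pair[OF x, of z0] norm_onb_pair[OF z] by simp
  have 2: "(cmod (cinner x0 z1))\<^sup>2 = 1 - ?v"
    using Parseval_onb_pair[OF z, of x0] norm_onb_pair[OF x] sym by simp
  have 3: "(cmod (cinner x1 z1))\<^sup>2 = ?v"
    using Parseval_onb_pair[OF x, of z1] norm_onb_pair[OF z] 2 by simp
  have "{(cmod (cinner x z))\<^sup>2 | x z. x \<in> {x0, x1} \<and> z \<in> {z0, z1}}
      = {?v, (cmod (cinner x0 z1))\<^sup>2, (cmod (cinner x1 z0))\<^sup>2, (cmod (cinner x1 z1))\<^sup>2}"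
    by auto
  also have "\<dots> = {?v, 1 - ?v}" unfolding 1 2 3 by auto
  finally have "c = max ?v (1 - ?v)" unfolding c by simp
  then show ?thesis by (simp add: max_def abs_if field_simps)
qed

theorem theorem3:
  fixes \<rho> :: "complex ^ 2 ^ 2" and X Z :: "(complex ^ 2) set" and c P :: real
  assumes "density_operator \<rho>"
    and "orthonormal_basis X" and "orthonormal_basis Z"
    and "c = Max {(cmod (cinner x z))\<^sup>2 | x z. x \<in> X \<and> z \<in> Z}"
    and "P = Re (trace (\<rho> ** \<rho>))"
  shows "coherence_CF X \<rho> + coherence_CF Z \<rho> \<ge>
         binary_entropy ((1 + sqrt (1 - 4 * (2 * P - 1) * sqrt c * (1 - sqrt c))) / 2)"
proof -
  obtain x0 x1 where X: "X = {x0, x1}" "onb_pair x0 x1"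
    using orthonormal_basis_pair[OF assms(2)] .
  obtain z0 z1 where Z: "Z = {z0, z1}" "onb_pair z0 z1"
    using orthonormal_basis_pair[OF assms(3)] .
  define a where "a = 2 * Re (cinner x0 (\<rho> *v x0)) - 1"
  define b where "b = 2 * Re (cinner z0 (\<rho> *v z0)) - 1"
  have n: "norm x0 = 1" "norm z0 = 1"
    using norm_onb_pair[OF X(2)] norm_onb_pair[OF Z(2)] by auto
  have c: "c = (1 + \<bar>2 * (cmod (cinner x0 z0))\<^sup>2 - 1\<bar>) / 2"
    using Max_overlap_onb_pair[OF X(2) Z(2)] assms(4) X Z by simp
  have u: "4 * (cmod (cinner x0 (\<rho> *v x1)))\<^sup>2 = (2 * P - 1) - a\<^sup>2"
    and v: "4 * (cmod (cinner z0 (\<rho> *v z1)))\<^sup>2 = (2 * P - 1) - b\<^sup>2"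
    using trace_square_onb_pair[OF assms(1)] X Z by (simp_all add: a_def b_def assms(5))
  \<comment> \<open>The factor 1 + |g| of the Gram bound, with g = n . m, is exactly 2 c.\<close>
  have ab: "a\<^sup>2 + b\<^sup>2 \<le> 2 * c * (2 * P - 1)"
  proof -
    have "2 * c = 1 + \<bar>2 * (cmod (cinner x0 z0))\<^sup>2 - 1\<bar>" unfolding c by simp
    then show ?thesis
      using qubit_expectation_bound[OF assms(1) n] unfolding a_def b_def assms(5)
      by (simp only: mult.commute)
  qed
  have P: "0 \<le> 2 * P - 1" "2 * P - 1 \<le> 1"
  proof -
    show "0 \<le> 2 * P - 1"
      using u zero_le_power2[of a] zero_le_power2[of "cmod (cinner x0 (\<rho> *v x1))"] by linarith
    obtain p where p: "cinner x0 (\<rho> *v x0) = complex_of_real p" "(cmod (cinner x0 (\<rho> *v x1)))\<^sup>2 \<le> p * (1 - p)"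
      using density_onb_pair[OF assms(1) X(2)] by metis
    \<comment> \<open>With the determinant bound this yields a^2 + 4 |w|^2 <= 1, that is, a Bloch
      vector of length at most 1.\<close>
    have "a\<^sup>2 = 1 - 4 * (p * (1 - p))"
      by (simp add: a_def p power2_eq_square algebra_simps)
    with u p(2) show "2 * P - 1 \<le> 1" by linarith
  qed
  have "1/2 \<le> c" unfolding c by simp
  moreover have "c \<le> 1"
  proof -
    have "(cmod (cinner x0 z0))\<^sup>2 \<le> 1"
      using Parseval_onb_pair[OF X(2), of z0] zero_le_power2[of "cmod (cinner x1 z0)"]
      unfolding n power_one by linarith
    moreover have "0 \<le> (cmod (cinner x0 z0))\<^sup>2" by (rule zero_le_power2)
    ultimately have "\<bar>2 * (cmod (cinner x0 z0))\<^sup>2 - 1\<bar> \<le> 1" unfolding abs_le_iff by linarith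
    then show ?thesis unfolding c by simp
  qed
  ultimately show ?thesis
    using coh_fun_sum_ge[OF P _ _ u v ab] coherence_CF_qubit[OF assms(1) X(2)]
      coherence_CF_qubit[OF assms(1) Z(2)] X Z by simp
qed

end
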